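(* Let $2k\ge16$, let $\mathfrak g=(\mathcal V_{2k},[\,,]+\Psi)$ be a $\mathbb Z_{>0}$-filtered deformation of $\mathcal V_{2k}$ and let $(x_1,x_2,\dots,x_5)$ be the homogeneous coordinates of the $UT_{2k}$-orbit $O_\Psi$ of $\Psi$. Then $\mathfrak g$ admits a symplectic structure if and only if $x_1=0$.
   Context: $\mathbb K$ is a field of characteristic zero; put $n=2k$. $\mathcal V_n$ is the Lie algebra over $\mathbb K$ with basis $e_1,\dots,e_n$ and $[e_i,e_j]=(j-i)e_{i+j}$ if $i+j\le n$, $[e_i,e_j]=0$ if $i+j>n$. A $\mathbb Z_{>0}$-filtered deformation of $\mathcal V_n$ is a skew-symmetric bilinear map $\Psi:\mathcal V_n\times\mathcal V_n\to\mathcal V_n$ of the form $\Psi=\sum_{l\ge1}\Psi_l$ with $\Psi_l(e_i,e_j)=c_{ij}^l e_{i+j+l}$ for $i+j+l\le n$ and $\Psi_l(e_i,e_j)=0$ otherwise, such that $[\,,]+\Psi$ is a Lie bracket. $V_n$ is the set of all such $\Psi$. A symplectic structure on a Lie algebra is a non-degenerate skew-symmetric bilinear form $\omega$ with $\omega([x,y],z)+\omega([y,z],x)+\omega([z,x],y)=0$ for all $x,y,z$ (bracket of $\mathfrak g$). $UT_n$ is the group of linear automorphisms of the vector space $\mathcal V_n$ with $\varphi(e_i)-e_i\in\mathrm{Span}(e_{i+1},\dots,e_n)$ for all $i$; it acts on $V_n$ by $(\varphi\star\Psi)(x,y)=\varphi^{-1}([\varphi x,\varphi y]+\Psi(\varphi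 x,\varphi y))-[x,y]$. Let $e^1,\dots,e^n$ be the dual basis; for $a\in\mathcal V_n$, $a\otimes(e^p\wedge e^q)$ denotes $(x,y)\mapsto (e^p(x)e^q(y)-e^p(y)e^q(x))\,a$. Put $\xi_0=e^2\wedge e^5-3e^3\wedge e^4$, $\xi_1(j)=\frac{j-1}{2}(e^2\wedge e^6-2e^3\wedge e^5)$, $\xi_2(j)=P_1(j)e^2\wedge e^7+P_2(j)e^3\wedge e^6+P_3(j)e^4\wedge e^5$, $\xi_3(j)=Q_1(j)e^2\wedge e^8+Q_2(j)e^3\wedge e^7+Q_3(j)e^4\wedge e^6$, $\xi_4(j)=Z_1(j)e^2\wedge e^9+Z_2(j)e^3\wedge e^8+Z_3(j)e^4\wedge e^7+Z_4(j)e^5\wedge e^6$, where $P_1(j)=\frac{1}{21}\left(5\binom j2+3j-6\right)$, $P_2(j)=-\frac1{21}\left(4\binom j2+15j-30\right)$, $P_3(j)=-\frac1{21}\left(13\binom j2-30j+60\right)$; $Q_1(j)=\frac1{28}\left(3\binom{j+1}3+4\binom{j+1}2-4(j+1)\right)$, $Q_2(j)=\frac1{14}\left(\binom{j+1}3-8\binom{j+1}2+8(j+1)\right)$, $Q_3(j)=\frac1{28}\left(-13\binom{j+1}3+20\binom{j+1}2-20(j+1)\right)$; $Z_1(j)=\frac1{22}\binom{j+2}4+\frac{23}{231}\binom{j+2}3-\frac7{198}\binom{j+2}2-\frac{59}{693}(j+2)+\frac{37}{231}$, $Z_2(j)=\frac{17}{154}\binom{j+2}4-\frac{62}{231}\binom{j+2}3-\frac{53}{1386}\binom{j+2}2+\frac{59}{99}(j+2)-\frac{37}{33}$,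 $Z_3(j)=-\frac{29}{154}\binom{j+2}4-\frac4{77}\binom{j+2}3+\frac{317}{462}\binom{j+2}2-\frac{59}{33}(j+2)+\frac{37}{11}$, $Z_4(j)=-\frac{47}{154}\binom{j+2}4+\frac{185}{231}\binom{j+2}3-\frac{2245}{1386}\binom{j+2}2+\frac{295}{99}(j+2)-\frac{185}{33}$. The basic cocycles are $\psi_{n,7+s}=e_{n-s}\otimes\xi_0+\sum_{p=1}^{s}e_{n-s+p}\otimes\xi_p(n-s)$ for $s=0,1,2,3,4$. For $n\ge16$ every $UT_n$-orbit in $V_n$ contains a unique element of the form $x_1\psi_{n,11}+x_2\psi_{n,10}+x_3\psi_{n,9}+x_4\psi_{n,8}+x_5\psi_{n,7}$; $(x_1,\dots,x_5)\in\mathbb K^5$ are called the homogeneous coordinates of the orbit. *)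

theory Defs
  imports Complex_Main
begin

definition bilinear_wrt ::
  "('a::field \<Rightarrow> 'v::ab_group_add \<Rightarrow> 'v) \<Rightarrow> ('a \<Rightarrow> 'w::ab_group_add \<Rightarrow> 'w) \<Rightarrow> ('v \<Rightarrow> 'v \<Rightarrow> 'w) \<Rightarrow> bool"
  where "bilinear_wrt s t f \<longleftrightarrow>
    (\<forall>x. Vector_Spaces.linear s t (\<lambda>y. f x y)) \<and> (\<forall>y. Vector_Spaces.linear s t (\<lambda>x. f x y))"

definition skew_symmetric :: "('v \<Rightarrow> 'v \<Rightarrow> 'w::ab_group_add) \<Rightarrow> bool"
  where "skew_symmetric f \<longleftrightarrow> (\<forall>x y. f x y = - f y x)"

definition lie_bracket ::
  "('a::field \<Rightarrow> 'v::ab_group_add \<Rightarrow> 'v) \<Rightarrow> ('v \<Rightarrow> 'v \<Rightarrow> 'v) \<Rightarrow> bool"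
  where "lie_bracket s B \<longleftrightarrow> bilinear_wrt s s B \<and> (\<forall>x. B x x = 0) \<and>
    (\<forall>x y z. B x (B y z) + B y (B z x) + B z (B x y) = 0)"

definition symplectic_structure ::
  "('a::field \<Rightarrow> 'v::ab_group_add \<Rightarrow> 'v) \<Rightarrow> ('v \<Rightarrow> 'v \<Rightarrow> 'v) \<Rightarrow> ('v \<Rightarrow> 'v \<Rightarrow> 'a) \<Rightarrow> bool"
  where "symplectic_structure s B \<omega> \<longleftrightarrow>
    bilinear_wrt s (*) \<omega> \<and> skew_symmetric \<omega> \<and>
    (\<forall>x. (\<forall>y. \<omega> x y = 0) \<longrightarrow> x = 0) \<and>
    (\<forall>x y z. \<omega> (B x y) z + \<omega> (B y z) x + \<omega> (B z x) y = 0)"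

text \<open>The vector space underlying \<open>\<V>\<^sub>n\<close> is the whole type \<open>'v\<close>, with ordered basis
  \<open>e 1, \<dots>, e n\<close>; the values of \<open>e\<close> at other indices are irrelevant.\<close>

locale Vn_space = vector_space scale
  for scale :: "'a::field_char_0 \<Rightarrow> 'v::ab_group_add \<Rightarrow> 'v" (infixr \<open>*s\<close> 75) +
  fixes n :: nat and e :: "nat \<Rightarrow> 'v"
  assumes inj_e: "inj_on e {1..n}"
    and independent_e: "independent (e ` {1..n})"
    and span_e: "span (e ` {1..n}) = UNIV"
begin

definition dual :: "nat \<Rightarrow> 'v \<Rightarrow> 'a"
  where "dual p v = representation (e ` {1..n}) v (e p)"

text \<open>Bilinear extension of \<open>[e\<^sub>i, e\<^sub>j] = (j - i) e\<^sub>i\<^sub>+\<^sub>j\<close> for \<open>i + j \<le> n\<close>;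
  see \<open>bracket_basis\<close> and \<open>bilinear_bracket\<close> below.\<close>

definition bracket :: "'v \<Rightarrow> 'v \<Rightarrow> 'v"
  where "bracket x y = (\<Sum>i=1..n. \<Sum>j=1..n.
    if i + j \<le> n then (dual i x * dual j y * (of_nat j - of_nat i)) *s e (i + j) else 0)"

text \<open>The terms with \<open>l > n\<close> of \<open>\<Psi> = (\<Sum>l\<ge>1. \<Psi>\<^sub>l)\<close> vanish, since \<open>i + j + l \<le> n\<close> is required.\<close>

definition deformations :: "('v \<Rightarrow> 'v \<Rightarrow> 'v) set"
  where "deformations = {\<Psi>. bilinear_wrt scale scale \<Psi> \<and> skew_symmetric \<Psi> \<and>
    (\<exists>c :: nat \<Rightarrow> nat \<Rightarrow> nat \<Rightarrow> 'a. \<forall>i\<in>{1..n}. \<forall>j\<in>{1..n}.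
      \<Psi> (e i) (e j) = (\<Sum>l=1..n. if i + j + l \<le> n then c l i j *s e (i + j + l) else 0)) \<and>
    lie_bracket scale (\<lambda>x y. bracket x y + \<Psi> x y)}"

definition UT :: "('v \<Rightarrow> 'v) set"
  where "UT = {\<phi>. Vector_Spaces.linear scale scale \<phi> \<and> bij \<phi> \<and>
    (\<forall>i\<in>{1..n}. \<phi> (e i) - e i \<in> span (e ` {i+1..n}))}"

definition act :: "('v \<Rightarrow> 'v) \<Rightarrow> ('v \<Rightarrow> 'v \<Rightarrow> 'v) \<Rightarrow> ('v \<Rightarrow> 'v \<Rightarrow> 'v)"
  where "act \<phi> \<Psi> = (\<lambda>x y. inv \<phi> (bracket (\<phi> x) (\<phi> y) + \<Psi> (\<phi> x) (\<phi> y)) - bracket x y)"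

definition UT_orbit :: "('v \<Rightarrow> 'v \<Rightarrow> 'v) \<Rightarrow> ('v \<Rightarrow> 'v \<Rightarrow> 'v) set"
  where "UT_orbit \<Psi> = (\<lambda>\<phi>. act \<phi> \<Psi>) ` UT"

definition wedge :: "nat \<Rightarrow> nat \<Rightarrow> 'v \<Rightarrow> 'v \<Rightarrow> 'a"
  where "wedge p q x y = dual p x * dual q y - dual p y * dual q x"

abbreviation binom :: "nat \<Rightarrow> nat \<Rightarrow> 'a"
  where "binom m r \<equiv> of_nat (m choose r)"

definition P1 :: "nat \<Rightarrow> 'a"
  where "P1 j = 1/21 * (5 * binom j 2 + 3 * of_nat j - 6)"
definition P2 :: "nat \<Rightarrow> 'a"
  where "P2 j = - (1/21) * (4 * binom j 2 + 15 * of_nat j - 30)"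
definition P3 :: "nat \<Rightarrow> 'a"
  where "P3 j = - (1/21) * (13 * binom j 2 - 30 * of_nat j + 60)"

definition Q1 :: "nat \<Rightarrow> 'a"
  where "Q1 j = 1/28 * (3 * binom (j+1) 3 + 4 * binom (j+1) 2 - 4 * of_nat (j+1))"
definition Q2 :: "nat \<Rightarrow> 'a"
  where "Q2 j = 1/14 * (binom (j+1) 3 - 8 * binom (j+1) 2 + 8 * of_nat (j+1))"
definition Q3 :: "nat \<Rightarrow> 'a"
  where "Q3 j = 1/28 * (- 13 * binom (j+1) 3 + 20 * binom (j+1) 2 - 20 * of_nat (j+1))"

definition Z1 :: "nat \<Rightarrow> 'a"
  where "Z1 j = 1/22 * binom (j+2) 4 + 23/231 * binom (j+2) 3 - 7/198 * binom (j+2) 2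
    - 59/693 * of_nat (j+2) + 37/231"
definition Z2 :: "nat \<Rightarrow> 'a"
  where "Z2 j = 17/154 * binom (j+2) 4 - 62/231 * binom (j+2) 3 - 53/1386 * binom (j+2) 2
    + 59/99 * of_nat (j+2) - 37/33"
definition Z3 :: "nat \<Rightarrow> 'a"
  where "Z3 j = - (29/154) * binom (j+2) 4 - 4/77 * binom (j+2) 3 + 317/462 * binom (j+2) 2
    - 59/33 * of_nat (j+2) + 37/11"
definition Z4 :: "nat \<Rightarrow> 'a"
  where "Z4 j = - (47/154) * binom (j+2) 4 + 185/231 * binom (j+2) 3 - 2245/1386 * binom (j+2) 2
    + 295/99 * of_nat (j+2) - 185/33"

text \<open>\<open>xi p j\<close> is \<open>\<xi>\<^sub>p(j)\<close>; \<open>\<xi>\<^sub>0\<close> does not depend on \<open>j\<close>. Only \<open>p \<le> 4\<close> is meaningful.\<close>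

definition xi :: "nat \<Rightarrow> nat \<Rightarrow> 'v \<Rightarrow> 'v \<Rightarrow> 'a"
  where "xi p j x y =
   (if p = 0 then wedge 2 5 x y - 3 * wedge 3 4 x y
    else if p = 1 then (of_nat j - 1) / 2 * (wedge 2 6 x y - 2 * wedge 3 5 x y)
    else if p = 2 then P1 j * wedge 2 7 x y + P2 j * wedge 3 6 x y + P3 j * wedge 4 5 x y
    else if p = 3 then Q1 j * wedge 2 8 x y + Q2 j * wedge 3 7 x y + Q3 j * wedge 4 6 x y
    else if p = 4 then Z1 j * wedge 2 9 x y + Z2 j * wedge 3 8 x y + Z3 j * wedge 4 7 x y
                       + Z4 j * wedge 5 6 x y
    else 0)"

text \<open>\<open>psi m\<close> is the basic cocycle \<open>\<psi>\<^sub>n\<^sub>,\<^sub>m\<close>, \<open>m = 7 + s\<close> with \<open>0 \<le> s \<le> 4\<close>.\<close>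

definition psi :: "nat \<Rightarrow> 'v \<Rightarrow> 'v \<Rightarrow> 'v"
  where "psi m x y = (let s = m - 7 in
    xi 0 (n - s) x y *s e (n - s) + (\<Sum>p=1..s. xi p (n - s) x y *s e (n - s + p)))"

text \<open>By definition the homogeneous coordinates of an orbit are the coefficients of the element of
  this form that it contains. For \<open>n \<ge> 16\<close> such an element exists and is unique in every orbit
  contained in \<open>deformations\<close>.\<close>

definition homogeneous_coordinates ::
  "('v \<Rightarrow> 'v \<Rightarrow> 'v) set \<Rightarrow> 'a \<times> 'a \<times> 'a \<times> 'a \<times> 'a \<Rightarrow> bool"
  where "homogeneous_coordinates O' = (\<lambda>(x\<^sub>1, x\<^sub>2, x\<^sub>3, x\<^sub>4, x\<^sub>5).
    (\<lambda>x y. x\<^sub>1 *s psi 11 x y + x\<^sub>2 *s psi 10 x y + x\<^sub>3 *s psi 9 x y + x\<^sub>4 *s psi 8 x y + x\<^sub>5 *s psi 7 x y)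
      \<in> O')"

lemma dual_basis:
  assumes "i \<in> {1..n}" "j \<in> {1..n}"
  shows "dual i (e j) = (if i = j then 1 else 0)"
  using assms inj_e independent_e
  by (auto simp: dual_def representation_basis inj_on_eq_iff)

lemma dual_add: "dual p (x + y) = dual p x + dual p y"
  unfolding dual_def by (subst representation_add[OF independent_e]) (simp_all only: span_e UNIV_I)

lemma dual_scale: "dual p (c *s x) = c * dual p x"
  unfolding dual_def by (subst representation_scale[OF independent_e]) (simp_all only: span_e UNIV_I)

lemma bracket_basis:
  assumes "i \<in> {1..n}" "j \<in> {1..n}"
  shows "bracket (e i) (e j) = (if i + j \<le> n then (of_nat j - of_nat i) *s e (i + j) else 0)"
proof -
  have "bracket (e i) (e j) = (\<Sum>i'=1..n. \<Sum>j'=1..n. if j' = j then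
      (if i' = i \<and> i + j \<le> n then (of_nat j - of_nat i) *s e (i + j) else 0) else 0)"
    unfolding bracket_def using assms by (intro sum.cong refl) (auto simp: dual_basis)
  also have "\<dots> = (\<Sum>i'=1..n. if i' = i then
      (if i + j \<le> n then (of_nat j - of_nat i) *s e (i + j) else 0) else 0)"
    using assms by (intro sum.cong refl) (simp add: sum.delta)
  also have "\<dots> = (if i + j \<le> n then (of_nat j - of_nat i) *s e (i + j) else 0)"
    using assms by (simp add: sum.delta)
  finally show ?thesis .
qed

lemma bilinear_bracket: "bilinear_wrt scale scale bracket"
  unfolding bilinear_wrt_def
proof (intro conjI allI)
  fix x
  show "Vector_Spaces.linear scale scale (bracket x)"
    by unfold_locales
      (auto simp: bracket_def dual_add dual_scale algebra_simps scale_sum_right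
         simp flip: sum.distrib intro!: sum.cong)
next
  fix y
  show "Vector_Spaces.linear scale scale (\<lambda>x. bracket x y)"
    by unfold_locales
      (auto simp: bracket_def dual_add dual_scale algebra_simps scale_sum_right
         simp flip: sum.distrib intro!: sum.cong)
qed

end

end

theory Submission
  imports Defs
begin

text \<open>The existence of a symplectic structure depends only on the isomorphism class of the Lie algebra,
  and elements of one \<open>UT\<close>-orbit define isomorphic brackets (\<open>symplectic_structure_act_iff\<close>). So one
  may replace \<open>\<Psi>\<close> by the combination of basic cocycles with coefficients \<open>x\<^sub>1, \<dots>, x\<^sub>5\<close>. Give \<open>e\<^sub>i\<close> the weight \<open>i\<close>, and a value \<open>\<omega>(e\<^sub>a, e\<^sub>b)\<close> of a bilinear form
  the weight \<open>a + b\<close>. The bracket of \<open>\<V>\<^sub>n\<close> preserves weights, while \<open>\<psi>\<^sub>n\<^sub>,\<^sub>7\<^sub>+\<^sub>s\<close> raises them by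
  \<open>n - 7 - s\<close>; thus \<open>x\<^sub>1\<close>, the coefficient of \<open>\<psi>\<^sub>n\<^sub>,\<^sub>1\<^sub>1\<close>, has the smallest shift, \<open>n - 11\<close>.

  A nondegenerate closed form must be nonzero on \<open>(e\<^sub>n, e\<^sub>1)\<close>, so it behaves like the cocycle
  of a central extension by a new element \<open>e\<^sub>n\<^sub>+\<^sub>1\<close> with \<open>[e\<^sub>1, e\<^sub>n] = (n - 1) e\<^sub>n\<^sub>+\<^sub>1\<close>.
  For \<open>x\<^sub>1 = 0\<close> this extension exists: \<open>\<psi>\<^sub>n\<^sub>,\<^sub>7\<^sub>+\<^sub>s\<close> prolongs to \<open>\<psi>\<^sub>n\<^sub>+\<^sub>1\<^sub>,\<^sub>8\<^sub>+\<^sub>s\<close> for \<open>s \<le> 3\<close> by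
  the term \<open>e\<^sub>n\<^sub>+\<^sub>1 \<otimes> \<xi>\<^sub>s\<^sub>+\<^sub>1(n - s)\<close>. The \<open>e\<^sub>n\<^sub>+\<^sub>1\<close>-component of the extended bracket is a closed
  form; its matrix is triangular with respect to the antidiagonal \<open>a + b = n + 1\<close>, whose
  entries \<open>b - a\<close> are odd integers, hence nonzero (\<open>extension_form_symplectic\<close>).
  Closedness comes down to the polynomial identities \<open>cocycle_identity\<close>.

  Conversely let \<open>\<omega>\<close> be symplectic. In weights above \<open>n\<close>, closedness on the triples
  \<open>(e\<^sub>1, e\<^sub>i, e\<^sub>j)\<close> only involves the undeformed bracket and gives a recursion along each
  antidiagonal. It kills all weights above \<open>n + 1\<close> (\<open>weight_above\<close>, where the parity of \<open>n\<close> enters)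
  and, together with one more triple, leaves only multiples of \<open>(b - a)\<close> in weight \<open>n + 1\<close>
  (\<open>weight_n_plus_1\<close>). This multiple cannot vanish, for otherwise \<open>e\<^sub>n\<close> would be in the radical.
  Finally, in weight 12 the deformation shifts into weight \<open>n + 1\<close> or higher, so that only the \<open>x\<^sub>1\<close>-terms
  survive. They form a 3-cocycle of \<open>\<V>\<^sub>n\<close> that has to be a coboundary. The homology cycle
  \<open>3 (1,3,8) - 8 (1,4,7) + 9 (1,5,6) + 21 (3,4,5)\<close> annihilates coboundaries but takes on it the value
  \<open>x\<^sub>1\<close> times a quantity that is nonzero for every \<open>n \<ge> 16\<close> (\<open>obstruction_value\<close>).
  Hence \<open>x\<^sub>1 = 0\<close> (\<open>obstruction\<close>).\<close>

section \<open>The polynomial identities of the basic cocycles\<close>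

lemma of_nat_choose_poly:
  fixes m :: nat
  shows "(of_nat (m choose 2) :: 'a::field_char_0) = of_nat m * (of_nat m - 1) / 2"
    and "(of_nat (m choose 3) :: 'a) = of_nat m * (of_nat m - 1) * (of_nat m - 2) / 6"
    and "(of_nat (m choose 4) :: 'a)
      = of_nat m * (of_nat m - 1) * (of_nat m - 2) * (of_nat m - 3) / 24"
  by (simp_all add: binomial_gbinomial gbinomial_prod_rev numeral_eq_Suc prod.atLeast0_lessThan_Suc
      mult.assoc)

definition cyclic_sum :: "(nat \<Rightarrow> nat \<Rightarrow> nat \<Rightarrow> 'b::ab_group_add) \<Rightarrow> nat \<Rightarrow> nat \<Rightarrow> nat \<Rightarrow> 'b"
  where "cyclic_sum f i j k = f i j k + f j k i + f k i j"

context Vn_space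
begin

definition wedge_coeff :: "nat \<Rightarrow> nat \<Rightarrow> nat \<Rightarrow> nat \<Rightarrow> 'a"
  where "wedge_coeff p q a b =
    (if a = p \<and> b = q then 1 else 0) - (if b = p \<and> a = q then 1 else 0)"

text \<open>The matrix of \<open>\<xi>\<^sub>p(j)\<close> in the basis, extended by zero to all pairs of naturals: the first index is
  often a sum \<open>i + j\<close> coming from a bracket, which may exceed \<open>n\<close>.\<close>

definition xi_coeff :: "nat \<Rightarrow> nat \<Rightarrow> nat \<Rightarrow> nat \<Rightarrow> 'a"
  where "xi_coeff p j a b =
   (if p = 0 then wedge_coeff 2 5 a b - 3 * wedge_coeff 3 4 a b
    else if p = 1 then (of_nat j - 1) / 2 * (wedge_coeff 2 6 a b - 2 * wedge_coeff 3 5 a b)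
    else if p = 2 then P1 j * wedge_coeff 2 7 a b + P2 j * wedge_coeff 3 6 a b
      + P3 j * wedge_coeff 4 5 a b
    else if p = 3 then Q1 j * wedge_coeff 2 8 a b + Q2 j * wedge_coeff 3 7 a b
      + Q3 j * wedge_coeff 4 6 a b
    else if p = 4 then Z1 j * wedge_coeff 2 9 a b + Z2 j * wedge_coeff 3 8 a b
      + Z3 j * wedge_coeff 4 7 a b + Z4 j * wedge_coeff 5 6 a b
    else 0)"

lemma xi_coeff_weight: "xi_coeff p j a b = 0" if "a + b \<noteq> p + 7"
  using that by (auto simp: xi_coeff_def wedge_coeff_def)

text \<open>For \<open>\<psi> = (\<Sum>p. e\<^sub>m\<^sub>+\<^sub>p \<otimes> \<xi>\<^sub>p(m))\<close> this is the coefficient of \<open>e\<^sub>m\<^sub>+\<^sub>q\<close> in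
  \<open>\<psi>([e\<^sub>i, e\<^sub>j], e\<^sub>k) + [\<psi>(e\<^sub>i, e\<^sub>j), e\<^sub>k]\<close>, computed with the structure constants \<open>j - i\<close> in
  large dimension. The vanishing of its cyclic sums is the \<open>e\<^sub>m\<^sub>+\<^sub>q\<close>-component of the cocycle
  condition for \<open>\<psi>\<close>.\<close>

definition cocycle_term :: "nat \<Rightarrow> nat \<Rightarrow> nat \<Rightarrow> nat \<Rightarrow> nat \<Rightarrow> 'a"
  where "cocycle_term q m i j k = (of_nat j - of_nat i) * xi_coeff q m (i + j) k
    + (\<Sum>p<q. xi_coeff p m i j * (if k + p = q then of_nat k - of_nat (m + p) else 0))"

lemma cocycle_term_weight: "cocycle_term q m i j k = 0" if "i + j + k \<noteq> q + 7"
  using that unfolding cocycle_term_def by (auto simp: xi_coeff_weight intro!: sum.neutral)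

lemmas coeff_polys = P1_def P2_def P3_def Q1_def Q2_def Q3_def Z1_def Z2_def Z3_def Z4_def
  of_nat_choose_poly of_nat_add of_nat_1 of_nat_numeral

lemma xi_coeff_antisym: "xi_coeff p j b a = - xi_coeff p j a b"
  by (auto simp: xi_coeff_def wedge_coeff_def)

lemma cocycle_term_antisym: "cocycle_term q m j i k = - cocycle_term q m i j k"
proof -
  have "(\<Sum>p<q. xi_coeff p m j i * (if k + p = q then of_nat k - of_nat (m + p) else 0)) =
    - (\<Sum>p<q. xi_coeff p m i j * (if k + p = q then of_nat k - of_nat (m + p) else 0))"
    by (simp add: xi_coeff_antisym[of _ _ j i] flip: sum_negf)
  then show ?thesis
    by (simp add: cocycle_term_def add.commute[of j i] algebra_simps)
qed

text \<open>Both summands are homogeneous, so a triple contributes only in weight \<open>q + 7\<close>. This leaves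
  fourteen triples, on each of which the claim is an identity between polynomials in \<open>m\<close>.\<close>

lemma cocycle_identity_increasing:
  assumes "q \<in> {1..4}" "1 \<le> i" "i < j" "j < k"
  shows "cyclic_sum (cocycle_term q m) i j k = 0"
proof (cases "i + j + k = q + 7")
  case False
  then show ?thesis
    by (simp add: cyclic_sum_def cocycle_term_weight add_ac)
next
  case True
  from assms(1) consider "q = 1" | "q = 2" | "q = 3" | "q = 4" by fastforce
  then have "(q, i, j, k) \<in> {(1,1,2,5), (1,1,3,4),
      (2,1,2,6), (2,1,3,5), (2,2,3,4),
      (3,1,2,7), (3,1,3,6), (3,1,4,5), (3,2,3,5),
      (4,1,2,8), (4,1,3,7), (4,1,4,6), (4,2,3,6), (4,2,4,5)}"
    using True assms by (cases; simp; presburger)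
  then show ?thesis
    by (elim insertE emptyE; simp only: prod.inject; elim conjE; simp only:;
        simp add: cyclic_sum_def cocycle_term_def xi_coeff_def
        wedge_coeff_def lessThan_nat_numeral coeff_polys; simp add: field_simps)
qed

text \<open>Skew-symmetry in the first two arguments makes the cyclic sum alternating.\<close>

lemma cyclic_sum_vanishes:
  fixes f :: "nat \<Rightarrow> nat \<Rightarrow> nat \<Rightarrow> 'b::field_char_0"
  assumes anti: "\<And>i j k. f j i k = - f i j k"
    and incr: "\<And>i j k. 1 \<le> i \<Longrightarrow> i < j \<Longrightarrow> j < k \<Longrightarrow> cyclic_sum f i j k = 0"
    and "1 \<le> i" "1 \<le> j" "1 \<le> k"
  shows "cyclic_sum f i j k = 0"
proof -
  have rot: "cyclic_sum f a b c = cyclic_sum f b c a" for a b c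
    by (simp add: cyclic_sum_def)
  have swap: "cyclic_sum f b a c = - cyclic_sum f a b c" for a b c
    using anti[of a b c] anti[of b c a] anti[of c a b] by (simp add: cyclic_sum_def)
  have eq: "cyclic_sum f a a c = 0" for a c
    using swap[of a a c] by simp
  consider "i = j" | "j = k" | "k = i" | "i < j" "j < k" | "j < k" "k < i" | "k < i" "i < j"
    | "j < i" "i < k" | "i < k" "k < j" | "k < j" "j < i"
    by linarith
  then show ?thesis
    by cases (metis assms(3-5) rot swap eq incr neg_equal_0_iff_equal)+
qed

lemma cocycle_identity:
  assumes "q \<in> {1..4}" "1 \<le> i" "1 \<le> j" "1 \<le> k"
  shows "cyclic_sum (cocycle_term q m) i j k = 0"
  using cyclic_sum_vanishes[OF cocycle_term_antisym cocycle_identity_increasing] assms by blast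

section \<open>Reduction to the basis\<close>

lemma vector_space_field: "vector_space ((*) :: 'a \<Rightarrow> 'a \<Rightarrow> 'a)"
  by unfold_locales (simp_all add: algebra_simps)

lemma linear_formI:
  assumes "\<And>u v. f (u + v) = f u + f v" "\<And>c u. f (c *s u) = c * f u"
  shows "Vector_Spaces.linear scale (*) f"
  using assms vector_space_field vector_space_axioms by (simp add: Vector_Spaces.linear_iff)

lemma linear_form_eq_0:
  assumes "Vector_Spaces.linear scale (*) f" "\<And>i. i \<in> {1..n} \<Longrightarrow> f (e i) = 0"
  shows "f x = 0"
proof -
  interpret Vector_Spaces.linear scale "(*)" f by fact
  have "x \<in> span (e ` {1..n})" by (simp only: span_e UNIV_I)
  then show ?thesis
    by (rule eq_0_on_span[rotated]) (use assms(2) in auto)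
qed

lemma bilinear_wrt_iff:
  "bilinear_wrt scale t f \<longleftrightarrow> vector_space t
    \<and> (\<forall>u v w. f (u + v) w = f u w + f v w \<and> f w (u + v) = f w u + f w v)
    \<and> (\<forall>c u w. f (c *s u) w = t c (f u w) \<and> f w (c *s u) = t c (f w u))"
  using vector_space_axioms by (auto simp: bilinear_wrt_def Vector_Spaces.linear_iff)

lemma bilinear_wrtI:
  assumes "vector_space t"
    and "\<And>u v w. f (u + v) w = f u w + f v w" "\<And>u v w. f w (u + v) = f w u + f w v"
    and "\<And>c u w. f (c *s u) w = t c (f u w)" "\<And>c u w. f w (c *s u) = t c (f w u)"
  shows "bilinear_wrt scale t f"
  unfolding bilinear_wrt_iff using assms by blast

lemma bilinear_wrtD:
  assumes "bilinear_wrt scale t f"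
  shows "f (u + v) w = f u w + f v w" "f w (u + v) = f w u + f w v"
    and "f (c *s u) w = t c (f u w)" "f w (c *s u) = t c (f w u)"
  using assms unfolding bilinear_wrt_iff by blast+

lemma wedge_linear:
  "wedge p q (u + v) w = wedge p q u w + wedge p q v w"
  "wedge p q w (u + v) = wedge p q w u + wedge p q w v"
  "wedge p q (c *s u) w = c * wedge p q u w"
  "wedge p q w (c *s u) = c * wedge p q w u"
  by (simp_all add: wedge_def dual_add dual_scale algebra_simps)

lemma xi_linear:
  "xi p j (u + v) w = xi p j u w + xi p j v w"
  "xi p j w (u + v) = xi p j w u + xi p j w v"
  "xi p j (c *s u) w = c * xi p j u w"
  "xi p j w (c *s u) = c * xi p j w u"
  unfolding xi_def wedge_linear by (simp_all add: ring_distribs mult_ac)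

lemma psi_linear:
  "psi m (u + v) w = psi m u w + psi m v w"
  "psi m w (u + v) = psi m w u + psi m w v"
  "psi m (c *s u) w = c *s psi m u w"
  "psi m w (c *s u) = c *s psi m w u"
  unfolding psi_def Let_def xi_linear
  by (simp_all add: scale_left_distrib scale_right_distrib sum.distrib scale_sum_right)

lemma xi_basis:
  assumes "9 \<le> n" "a \<in> {1..n}" "b \<in> {1..n}"
  shows "xi p j (e a) (e b) = xi_coeff p j a b"
proof -
  have dual: "dual r (e c) = (if c = r then 1 else 0)" if "r \<in> {1..9}" "c \<in> {a, b}" for r c
    using assms that dual_basis[of r c] by auto
  have "wedge r s (e a) (e b) = wedge_coeff r s a b" if "r \<in> {1..9}" "s \<in> {1..9}" for r s
  proof -
    have d: "dual r (e a) = (if a = r then 1 else 0)" "dual r (e b) = (if b = r then 1 else 0)"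
      "dual s (e a) = (if a = s then 1 else 0)" "dual s (e b) = (if b = s then 1 else 0)"
      using that dual by blast+
    show ?thesis
      unfolding wedge_def wedge_coeff_def d
      by (cases "a = r"; cases "b = s"; cases "b = r"; cases "a = s";
          simp only: simp_thms if_True if_False; simp)
  qed
  then show ?thesis unfolding xi_def xi_coeff_def by simp
qed

lemma psi_basis:
  assumes "9 \<le> n" "a \<in> {1..n}" "b \<in> {1..n}"
  shows "psi (7 + s) (e a) (e b) = (\<Sum>p\<le>s. xi_coeff p (n - s) a b *s e (n - s + p))"
proof -
  have "{..s} = insert 0 {1..s}" by auto
  then show ?thesis by (simp add: psi_def xi_basis[OF assms])
qed

text \<open>The coordinates are indexed by the length \<open>s\<close> of the cocycle, so \<open>y s\<close> is the homogeneous
  coordinate \<open>x\<^sub>5\<^sub>-\<^sub>s\<close>; in particular \<open>y 4\<close> is \<open>x\<^sub>1\<close>.\<close>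

definition normal_form :: "(nat \<Rightarrow> 'a) \<Rightarrow> 'v \<Rightarrow> 'v \<Rightarrow> 'v"
  where "normal_form y u v = (\<Sum>s\<le>4. y s *s psi (7 + s) u v)"

definition normal_bracket :: "(nat \<Rightarrow> 'a) \<Rightarrow> 'v \<Rightarrow> 'v \<Rightarrow> 'v"
  where "normal_bracket y u v = bracket u v + normal_form y u v"

lemma normal_form_linear:
  "normal_form y (u + v) w = normal_form y u w + normal_form y v w"
  "normal_form y w (u + v) = normal_form y w u + normal_form y w v"
  "normal_form y (c *s u) w = c *s normal_form y u w"
  "normal_form y w (c *s u) = c *s normal_form y w u"
  unfolding normal_form_def psi_linear
  by (simp_all only: scale_right_distrib sum.distrib scale_sum_right scale_left_commute)

lemma bilinear_normal_bracket: "bilinear_wrt scale scale (normal_bracket y)"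
  by (intro bilinear_wrtI vector_space_axioms;
      unfold normal_bracket_def normal_form_linear bilinear_wrtD[OF bilinear_bracket] scale_right_distrib)
    (simp_all only: add.assoc add.commute add.left_commute)

text \<open>The zero extension absorbs the case distinction \<open>i + j \<le> n\<close> of the bracket, because a bracket that
  leaves the basis is zero.\<close>

definition form_matrix :: "('v \<Rightarrow> 'v \<Rightarrow> 'a) \<Rightarrow> nat \<Rightarrow> nat \<Rightarrow> 'a"
  where "form_matrix \<omega> a b = (if a \<in> {1..n} \<and> b \<in> {1..n} then \<omega> (e a) (e b) else 0)"

text \<open>\<open>\<omega>([e\<^sub>i, e\<^sub>j] + \<Psi>(e\<^sub>i, e\<^sub>j), e\<^sub>k)\<close> for the normal form \<open>\<Psi>\<close> with coordinates \<open>y\<close>, written through the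
  matrix \<open>w\<close> of \<open>\<omega>\<close>. Both directions of the theorem are computations with this expression.\<close>

definition bracket_term :: "(nat \<Rightarrow> 'a) \<Rightarrow> (nat \<Rightarrow> nat \<Rightarrow> 'a) \<Rightarrow> nat \<Rightarrow> nat \<Rightarrow> nat \<Rightarrow> 'a"
  where "bracket_term y w i j k = (of_nat j - of_nat i) * w (i + j) k
    + (\<Sum>s\<le>4. y s * (\<Sum>p\<le>s. xi_coeff p (n - s) i j * w (n - s + p) k))"

lemma form_normal_bracket_basis:
  assumes "bilinear_wrt scale (*) \<omega>" "9 \<le> n" "i \<in> {1..n}" "j \<in> {1..n}" "k \<in> {1..n}"
  shows "\<omega> (normal_bracket y (e i) (e j)) (e k) = bracket_term y (form_matrix \<omega>) i j k"
proof -
  interpret Vector_Spaces.linear scale "(*)" "\<lambda>u. \<omega> u (e k)"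
    using assms(1) by (simp add: bilinear_wrt_def)
  have range: "n - s + p \<in> {1..n}" if "s \<le> 4" "p \<le> s" for s p
    using that assms(2) by auto
  have "\<omega> (bracket (e i) (e j)) (e k) = (of_nat j - of_nat i) * form_matrix \<omega> (i + j) k"
    using assms(3-5) by (auto simp: bracket_basis form_matrix_def scale zero)
  moreover have "\<omega> (normal_form y (e i) (e j)) (e k) =
      (\<Sum>s\<le>4. y s * (\<Sum>p\<le>s. xi_coeff p (n - s) i j * form_matrix \<omega> (n - s + p) k))"
    unfolding normal_form_def psi_basis[OF assms(2-4)]
    using range assms(5) by (simp add: sum scale form_matrix_def)
  ultimately show ?thesis by (simp add: normal_bracket_def add bracket_term_def)
qed

lemma closed_iff_basis:
  assumes \<omega>: "bilinear_wrt scale (*) \<omega>" and "9 \<le> n"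
  shows "(\<forall>u v w. \<omega> (normal_bracket y u v) w + \<omega> (normal_bracket y v w) u
      + \<omega> (normal_bracket y w u) v = 0) \<longleftrightarrow>
    (\<forall>i\<in>{1..n}. \<forall>j\<in>{1..n}. \<forall>k\<in>{1..n}. cyclic_sum (bracket_term y (form_matrix \<omega>)) i j k = 0)"
    (is "(\<forall>u v w. ?T u v w = 0) \<longleftrightarrow> ?R")
proof -
  have basis: "?T (e i) (e j) (e k) = cyclic_sum (bracket_term y (form_matrix \<omega>)) i j k"
    if "i \<in> {1..n}" "j \<in> {1..n}" "k \<in> {1..n}" for i j k
    using that by (simp add: form_normal_bracket_basis[OF assms] cyclic_sum_def)
  note bil = bilinear_wrtD[OF \<omega>] bilinear_wrtD[OF bilinear_normal_bracket]
  have lin1: "Vector_Spaces.linear scale (*) (\<lambda>u. ?T u v w)" for v w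
    by (intro linear_formI) (simp_all add: bil ring_distribs)
  have lin2: "Vector_Spaces.linear scale (*) (\<lambda>v. ?T u v w)" for u w
    by (intro linear_formI) (simp_all add: bil ring_distribs)
  have lin3: "Vector_Spaces.linear scale (*) (\<lambda>w. ?T u v w)" for u v
    by (intro linear_formI) (simp_all add: bil ring_distribs)
  show ?thesis
  proof
    assume ?R
    then have "?T (e i) (e j) (e k) = 0" if "i \<in> {1..n}" "j \<in> {1..n}" "k \<in> {1..n}" for i j k
      using that basis by simp
    then have "?T (e i) (e j) w = 0" if "i \<in> {1..n}" "j \<in> {1..n}" for i j w
      by (rule linear_form_eq_0[OF lin3]) (use that in auto)
    then have "?T (e i) v w = 0" if "i \<in> {1..n}" for i v w
      by (rule linear_form_eq_0[OF lin2]) (use that in auto)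
    then have "?T u v w = 0" for u v w
      by (rule linear_form_eq_0[OF lin1])
    then show "\<forall>u v w. ?T u v w = 0" by blast
  qed (use basis in simp)
qed

section \<open>A symplectic form from the next central extension\<close>

text \<open>The structure constants of \<open>e\<^sub>n\<^sub>+\<^sub>1\<close> in \<open>\<V>\<^sub>n\<^sub>+\<^sub>1\<close>.\<close>

definition leading_coeff :: "nat \<Rightarrow> nat \<Rightarrow> 'a"
  where "leading_coeff a b = (if a + b = n + 1 then of_nat b - of_nat a else 0)"

text \<open>The \<open>e\<^sub>n\<^sub>+\<^sub>1\<close>-component of the bracket on \<open>\<V>\<^sub>n\<^sub>+\<^sub>1\<close> deformed by the prolonged cocycles
  \<open>\<psi>\<^sub>n\<^sub>+\<^sub>1\<^sub>,\<^sub>8\<^sub>+\<^sub>s\<close>, \<open>s \<le> 3\<close>. A form that arises as such a component is closed as soon as the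
  extended bracket satisfies the Jacobi identity.\<close>

definition extension_form :: "(nat \<Rightarrow> 'a) \<Rightarrow> 'v \<Rightarrow> 'v \<Rightarrow> 'a"
  where "extension_form y u v =
    (\<Sum>i=1..n. (of_nat (n + 1 - i) - of_nat i) * (dual i u * dual (n + 1 - i) v))
    + (\<Sum>s<4. y s * xi (s + 1) (n - s) u v)"

lemma bilinear_extension_form: "bilinear_wrt scale (*) (extension_form y)"
proof (rule bilinear_wrtI[OF vector_space_field])
  fix u v w and c :: 'a
  show "extension_form y (u + v) w = extension_form y u w + extension_form y v w"
    unfolding extension_form_def xi_linear dual_add distrib_left distrib_right sum.distrib
    by (simp only: add.assoc add.left_commute)
  show "extension_form y w (u + v) = extension_form y w u + extension_form y w v"
    unfolding extension_form_def xi_linear dual_add distrib_left distrib_right sum.distrib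
    by (simp only: add.assoc add.left_commute)
  show "extension_form y (c *s u) w = c * extension_form y u w"
    unfolding extension_form_def xi_linear dual_scale distrib_left sum_distrib_left
    by (simp only: mult.assoc mult.left_commute)
  show "extension_form y w (c *s u) = c * extension_form y w u"
    unfolding extension_form_def xi_linear dual_scale distrib_left sum_distrib_left
    by (simp only: mult.assoc mult.left_commute)
qed

lemma extension_form_basis:
  assumes "9 \<le> n" "a \<in> {1..n}" "b \<in> {1..n}"
  shows "extension_form y (e a) (e b) =
    leading_coeff a b + (\<Sum>s<4. y s * xi_coeff (s + 1) (n - s) a b)"
proof -
  have "(\<Sum>i=1..n. (of_nat (n + 1 - i) - of_nat i) * (dual i (e a) * dual (n + 1 - i) (e b)))
    = (\<Sum>i=1..n. if i = a then leading_coeff a b else 0)"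
  proof (intro sum.cong refl)
    fix i assume i: "i \<in> {1..n}"
    then have r: "n + 1 - i \<in> {1..n}" and eq: "n + 1 - i = b \<longleftrightarrow> i + b = n + 1"
      using assms(3) by auto
    show "(of_nat (n + 1 - i) - of_nat i) * (dual i (e a) * dual (n + 1 - i) (e b))
        = (if i = a then leading_coeff a b else 0)"
      unfolding dual_basis[OF i assms(2)] dual_basis[OF r assms(3)] leading_coeff_def
      using eq by auto
  qed
  also have "\<dots> = leading_coeff a b"
    using assms by (simp add: sum.delta)
  finally show ?thesis
    by (simp add: extension_form_def xi_basis[OF assms])
qed

lemma skew_form_from_basis:
  assumes \<omega>: "bilinear_wrt scale (*) \<omega>"
    and "\<And>i j. i \<in> {1..n} \<Longrightarrow> j \<in> {1..n} \<Longrightarrow> \<omega> (e j) (e i) = - \<omega> (e i) (e j)"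
  shows "skew_symmetric \<omega>"
proof -
  note bil = bilinear_wrtD[OF \<omega>]
  have "\<omega> (e i) v + \<omega> v (e i) = 0" if "i \<in> {1..n}" for i v
    by (rule linear_form_eq_0[of "\<lambda>v. \<omega> (e i) v + \<omega> v (e i)"])
      (use assms(2)[OF that] in \<open>auto intro!: linear_formI simp: bil ring_distribs\<close>)
  then have "\<omega> u v + \<omega> v u = 0" for u v
    by (rule linear_form_eq_0[of "\<lambda>u. \<omega> u v + \<omega> v u", rotated])
      (auto intro!: linear_formI simp: bil ring_distribs)
  then show ?thesis unfolding skew_symmetric_def eq_neg_iff_add_eq_0 by blast
qed

lemma basis_expansion: "(\<Sum>i=1..n. dual i x *s e i) = x"
proof -
  have "x \<in> span (e ` {1..n})" by (simp only: span_e UNIV_I)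
  then have "(\<Sum>b\<in>e ` {1..n}. representation (e ` {1..n}) x b *s b) = x"
    by (intro sum_representation_eq independent_e) auto
  then show ?thesis unfolding dual_def sum.reindex[OF inj_e] o_def .
qed

text \<open>The coordinates of a vector in the radical vanish one after the other: pairing it with
  \<open>e\<^sub>n\<^sub>+\<^sub>1\<^sub>-\<^sub>t\<close> involves only the coordinates up to \<open>t\<close>, the last one with a nonzero factor.\<close>

lemma antitriangular_nondegenerate:
  assumes \<omega>: "bilinear_wrt scale (*) \<omega>"
    and above: "\<And>a b. a \<in> {1..n} \<Longrightarrow> b \<in> {1..n} \<Longrightarrow> n + 1 < a + b \<Longrightarrow> \<omega> (e a) (e b) = 0"
    and diag: "\<And>a. a \<in> {1..n} \<Longrightarrow> \<omega> (e a) (e (n + 1 - a)) \<noteq> 0"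
    and rad: "\<forall>v. \<omega> x v = 0"
  shows "x = 0"
proof -
  interpret Vector_Spaces.linear scale "(*)" "\<lambda>u. \<omega> u (e k)" for k
    using \<omega> by (simp add: bilinear_wrt_def)
  have "dual t x = 0" if "t \<in> {1..n}" for t
    using that
  proof (induction t rule: less_induct)
    case (less t)
    have "0 = \<omega> (\<Sum>i=1..n. dual i x *s e i) (e (n + 1 - t))"
      unfolding basis_expansion using rad by simp
    also have "\<dots> = (\<Sum>i=1..n. dual i x * \<omega> (e i) (e (n + 1 - t)))"
      by (simp add: sum scale)
    also have "\<dots> = (\<Sum>i=1..n. if i = t then dual t x * \<omega> (e t) (e (n + 1 - t)) else 0)"
    proof (intro sum.cong refl)
      fix i assume i: "i \<in> {1..n}"
      consider "i < t" | "i = t" | "t < i" by linarith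
      then show "dual i x * \<omega> (e i) (e (n + 1 - t)) =
          (if i = t then dual t x * \<omega> (e t) (e (n + 1 - t)) else 0)"
      proof cases
        case 3
        moreover have "n + 1 - t \<in> {1..n}" using less.prems by auto
        ultimately show ?thesis using i less.prems above[of i "n + 1 - t"] by auto
      qed (use i less.IH in auto)
    qed
    also have "\<dots> = dual t x * \<omega> (e t) (e (n + 1 - t))"
      using less.prems by (simp add: sum.delta)
    finally show ?case using diag[OF less.prems] by simp
  qed
  then have "(\<Sum>i=1..n. dual i x *s e i) = 0" by (intro sum.neutral) auto
  then show ?thesis unfolding basis_expansion .
qed

text \<open>The corrections \<open>\<xi>\<^sub>s\<^sub>+\<^sub>1\<close> live in weights at most 11. On the values \<open>e\<^sub>n\<^sub>-\<^sub>s, \<dots>, e\<^sub>n\<close> of the deformation they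
  vanish since \<open>n \<ge> 16\<close>, so closedness has no terms quadratic in \<open>y\<close>. What remains is the Jacobi identity
  of \<open>\<V>\<^sub>n\<^sub>+\<^sub>1\<close> and, for each \<open>s\<close> separately, \<open>cocycle_identity\<close>.\<close>

lemma extension_form_symplectic:
  assumes "16 \<le> n" "even n" "y 4 = 0"
  shows "symplectic_structure scale (normal_bracket y) (extension_form y)"
proof -
  let ?\<omega> = "extension_form y"
  let ?m = "form_matrix ?\<omega>"
  have n9: "9 \<le> n" using assms(1) by simp
  note basis = extension_form_basis[OF n9]
  have m: "?m a b = leading_coeff a b + (\<Sum>s<4. y s * xi_coeff (s + 1) (n - s) a b)"
    if "1 \<le> a" "b \<in> {1..n}" for a b
    using that assms(1)
    by (auto simp: form_matrix_def basis leading_coeff_def xi_coeff_weight intro!: sum.neutral)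
  \<comment> \<open>the deformation takes values in the span of the \<open>e\<^sub>a\<close> with \<open>a \<ge> n - 4 \<ge> 12\<close>\<close>
  have m_large: "?m a b = leading_coeff a b" if "12 \<le> a" "b \<in> {1..n}" for a b
    using that by (subst m) (auto simp: xi_coeff_weight intro!: sum.neutral)
  have terms: "bracket_term y ?m i j k = (of_nat j - of_nat i) * leading_coeff (i + j) k
      + (\<Sum>s<4. y s * cocycle_term (s + 1) (n - s) i j k)"
    if "i \<in> {1..n}" "j \<in> {1..n}" "k \<in> {1..n}" for i j k
  proof -
    have "(\<Sum>s\<le>4. y s * (\<Sum>p\<le>s. xi_coeff p (n - s) i j * ?m (n - s + p) k))
      = (\<Sum>s<4. y s * (\<Sum>p\<le>s. xi_coeff p (n - s) i j * ?m (n - s + p) k))"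
    proof -
      have "{..4} = insert 4 {..<4::nat}" by auto
      then show ?thesis using assms(3) by simp
    qed
    also have "\<dots> = (\<Sum>s<4. y s * (\<Sum>p<s+1. xi_coeff p (n - s) i j *
        (if k + p = s + 1 then of_nat k - of_nat (n - s + p) else 0)))"
    proof (intro sum.cong refl arg_cong2[where f = "(*)"])
      fix s assume "s \<in> {..<4::nat}"
      then show "?m (n - s + p) k = (if k + p = s + 1 then of_nat k - of_nat (n - s + p) else 0)" for p
        using assms(1) that(3) by (subst m_large) (auto simp: leading_coeff_def)
    qed auto
    moreover have "?m (i + j) k =
      leading_coeff (i + j) k + (\<Sum>s<4. y s * xi_coeff (s + 1) (n - s) (i + j) k)"
      using that by (intro m) auto
    moreover have "(\<Sum>s<4. y s * cocycle_term (s + 1) (n - s) i j k) =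
        (of_nat j - of_nat i) * (\<Sum>s<4. y s * xi_coeff (s + 1) (n - s) (i + j) k)
        + (\<Sum>s<4. y s * (\<Sum>p<s+1. xi_coeff p (n - s) i j *
            (if k + p = s + 1 then of_nat k - of_nat (n - s + p) else 0)))"
      unfolding cocycle_term_def
      by (simp only: distrib_left sum.distrib sum_distrib_left mult.left_commute)
    ultimately show ?thesis
      unfolding bracket_term_def by (simp only: distrib_left add.assoc)
  qed
  have "cyclic_sum (bracket_term y ?m) i j k = 0"
    if ijk: "i \<in> {1..n}" "j \<in> {1..n}" "k \<in> {1..n}" for i j k
  proof -
    have lead: "cyclic_sum (\<lambda>i j k. (of_nat j - of_nat i) * leading_coeff (i + j) k) i j k = 0"
      by (simp add: cyclic_sum_def leading_coeff_def algebra_simps)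
    have "cyclic_sum (bracket_term y ?m) i j k
      = cyclic_sum (\<lambda>i j k. (of_nat j - of_nat i) * leading_coeff (i + j) k) i j k
        + (\<Sum>s<4. y s * cyclic_sum (cocycle_term (s + 1) (n - s)) i j k)"
      using ijk by (simp add: cyclic_sum_def terms algebra_simps sum.distrib)
    also have "\<dots> = 0"
      using ijk lead by (simp add: cocycle_identity)
    finally show ?thesis .
  qed
  then have closed: "\<forall>u v w. ?\<omega> (normal_bracket y u v) w + ?\<omega> (normal_bracket y v w) u
      + ?\<omega> (normal_bracket y w u) v = 0"
    by (subst closed_iff_basis[OF bilinear_extension_form n9]) blast
  have skew: "skew_symmetric ?\<omega>"
  proof (rule skew_form_from_basis[OF bilinear_extension_form])
    fix i j assume ij: "i \<in> {1..n}" "j \<in> {1..n}"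
    show "?\<omega> (e j) (e i) = - ?\<omega> (e i) (e j)"
      unfolding basis[OF ij] basis[OF ij(2) ij(1)] xi_coeff_antisym[of _ _ j i]
      by (simp add: leading_coeff_def sum_negf add.commute)
  qed
  have "x = 0" if "\<forall>v. ?\<omega> x v = 0" for x
  proof (rule antitriangular_nondegenerate[OF bilinear_extension_form _ _ that])
    fix a assume a: "a \<in> {1..n}"
    have "of_nat (n + 1 - a) \<noteq> (of_nat a :: 'a)"
      unfolding of_nat_eq_iff using assms(2) a by (auto; presburger)
    moreover have "(\<Sum>s<4. y s * xi_coeff (s + 1) (n - s) a (n + 1 - a)) = 0"
      using a assms(1) by (intro sum.neutral) (auto simp: xi_coeff_weight)
    moreover have "n + 1 - a \<in> {1..n}" "a + (n + 1 - a) = n + 1" using a by auto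
    ultimately show "?\<omega> (e a) (e (n + 1 - a)) \<noteq> 0"
      using basis[OF a] by (simp only: leading_coeff_def add_0_right simp_thms if_True right_minus_eq)
  next
    fix a b assume ab: "a \<in> {1..n}" "b \<in> {1..n}" "n + 1 < a + b"
    show "?\<omega> (e a) (e b) = 0"
      unfolding basis[OF ab(1,2)] using assms(1) ab(3)
      by (auto simp: leading_coeff_def xi_coeff_weight intro!: sum.neutral)
  qed
  then show ?thesis
    using closed skew bilinear_extension_form by (simp add: symplectic_structure_def)
qed

section \<open>The obstruction in weight twelve\<close>

lemma xi_coeff_1: "xi_coeff p j 1 b = 0" "xi_coeff p j b 1 = 0"
  by (simp_all add: xi_coeff_def wedge_coeff_def)

text \<open>The value of the cycle \<open>3 (1,3,8) - 8 (1,4,7) + 9 (1,5,6) + 21 (3,4,5)\<close> on the \<open>x\<^sub>1\<close>-terms, divided by the scale of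
  \<open>\<omega>\<close> in weight \<open>n + 1\<close>, for \<open>n = m + 16\<close>. As a polynomial in \<open>m\<close> it has
  positive coefficients only, and hence no root among the natural numbers.\<close>

lemma obstruction_value:
  "(3 * Z2 (m + 12) - 8 * Z3 (m + 12) + 9 * Z4 (m + 12)) * (1 - of_nat (m + 16))
    + 21 * (P3 (m + 12) * (3 - of_nat (m + 14)) - 3 * (5 - of_nat (m + 12))
        + (of_nat (m + 12) - 1) * (4 - of_nat (m + 13)))
   = 5 * of_nat (m ^ 5 + 35 * m ^ 4 + 503 * m ^ 3 + 3589 * m\<^sup>2 + 12720 * m + 17712) / 132"
  by (simp add: coeff_polys field_simps power_numeral_reduce)

text \<open>
  In what follows \<open>A\<close> is the matrix of a closed form on the normal form with coordinates \<open>y\<close>, extended by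
  zero.\<close>

context
  fixes y :: "nat \<Rightarrow> 'a" and A :: "nat \<Rightarrow> nat \<Rightarrow> 'a"
  assumes n: "16 \<le> n" "even n"
    and anti: "\<And>a b. A b a = - A a b"
    and outside: "\<And>a b. n < a \<Longrightarrow> A a b = 0"
    and closed: "\<And>i j k. i \<in> {1..n} \<Longrightarrow> j \<in> {1..n} \<Longrightarrow> k \<in> {1..n} \<Longrightarrow>
      cyclic_sum (bracket_term y A) i j k = 0"
begin

lemma outside_right: "n < b \<Longrightarrow> A a b = 0"
  using outside[of b a] anti[of a b] by simp

text \<open>The deformation is supported on pairs of basis vectors from \<open>e\<^sub>2, \<dots>, e\<^sub>9\<close> of weight between 7 and 11.\<close>

lemma bracket_term_undeformed:
  assumes "i = 1 \<or> j = 1 \<or> 11 < i + j \<or> i + j < 7"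
  shows "bracket_term y A i j k = (of_nat j - of_nat i) * A (i + j) k"
proof -
  have "xi_coeff p (n - s) i j = 0" if "p \<le> s" "s \<le> 4" for p s
    using assms that xi_coeff_1 by (auto simp: xi_coeff_weight)
  then show ?thesis by (simp add: bracket_term_def)
qed

text \<open>Closedness on \<open>(e\<^sub>1, e\<^sub>i, e\<^sub>j)\<close>: the action of \<open>e\<^sub>1\<close> relates neighbours on the antidiagonal of weight
  \<open>i + j + 1\<close>, up to the entry in the first column.\<close>

lemma shift_relation:
  assumes "i \<in> {1..n}" "j \<in> {1..n}" "11 < i + j"
  shows "(of_nat i - 1) * A (i + 1) j + (of_nat j - of_nat i) * A (i + j) 1
    = (of_nat j - 1) * A (j + 1) i"
proof -
  have "cyclic_sum (bracket_term y A) 1 i j = 0"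
    using n assms by (intro closed) auto
  then show ?thesis
    using assms(3) by (simp add: cyclic_sum_def bracket_term_undeformed algebra_simps)
qed

text \<open>This weight is even because \<open>n\<close> is, so its antidiagonal meets the diagonal in the entry
  \<open>(k + 1, k + 1)\<close>, which is zero by skew-symmetry. The shift relation propagates the zero outwards.
  Starting from the border would fail in this weight, as the factor \<open>i - 1\<close> vanishes there.\<close>

lemma weight_n_plus_2:
  assumes "n = 2 * k" "d \<le> k"
  shows "A (k + 1 - d) (k + 1 + d) = 0"
  using assms(2)
proof (induction d)
  case 0
  then show ?case using anti[of "k + 1" "k + 1"] by simp
next
  case (Suc d)
  show ?case
  proof (cases "n < k + 1 + Suc d")
    case True
    then show ?thesis by (rule outside_right)
  next
    case False
    then have "k - d \<in> {1..n}" "k + 1 + d \<in> {1..n}" "11 < k - d + (k + 1 + d)"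
      and "k - d + 1 = k + 1 - d" "n < k - d + (k + 1 + d)"
      using assms(1) n by auto
    then have "of_nat (k + d) * A (k + 1 + d + 1) (k - d) = 0"
      using shift_relation[of "k - d" "k + 1 + d"] Suc by (simp add: outside)
    moreover have "k + d \<noteq> 0" using assms n by auto
    ultimately show ?thesis
      using anti[of "k - d" "k + 1 + d + 1"] by (auto simp flip: of_nat_add)
  qed
qed

text \<open>Induction inwards from the border: entries beyond index \<open>n\<close> are zero, and the factor \<open>i - 1\<close> of the shift
  relation vanishes only at the entry \<open>(2, n)\<close>, which is covered by \<open>weight_n_plus_2\<close>.\<close>

lemma weight_above:
  assumes "n + 2 \<le> a + b" "1 \<le> b"
  shows "A a b = 0"
  using assms
proof (induction a arbitrary: b)
  case 0
  then show ?case by (simp add: outside_right)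
next
  case (Suc i)
  obtain k where k: "n = 2 * k" using n(2) by blast
  consider "n < Suc i \<or> n < b" | "i = 1" "b = n" | "2 \<le> i" "Suc i \<le> n" "b \<le> n"
    using Suc.prems by linarith
  then show ?case
  proof cases
    case 1
    then show ?thesis using outside outside_right by blast
  next
    case 2
    have "k + 1 - (k - 1) = 2" "k + 1 + (k - 1) = n" using k n by auto
    then show ?thesis
      using weight_n_plus_2[OF k, of "k - 1"] 2 by (simp add: numeral_2_eq_2)
  next
    case 3
    then have "i \<in> {1..n}" "b \<in> {1..n}" "11 < i + b" "n < i + b"
      using Suc.prems n by auto
    then have "(of_nat i - 1) * A (i + 1) b = (of_nat b - 1) * A (b + 1) i"
      using shift_relation[of i b] by (simp add: outside)
    also have "A (b + 1) i = 0"
      using Suc.IH[of "b + 1"] Suc.prems anti[of i "b + 1"] by simp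
    finally have "of_nat i = (1 :: 'a) \<or> A (Suc i) b = 0" by simp
    then show ?thesis using 3(1) by (metis of_nat_1 of_nat_eq_iff Suc_1 not_less_eq_eq le_refl)
  qed
qed

text \<open>The shift relation has a two-dimensional space of solutions in this weight, spanned by the form
  \<open>b - a\<close> and by one that vanishes on \<open>(e\<^sub>1, e\<^sub>n)\<close>. Closedness on \<open>(e\<^sub>2, e\<^sub>3, e\<^sub>n\<^sub>-\<^sub>4)\<close> excludes the
  latter.\<close>

lemma weight_n_plus_1:
  assumes "A n 1 = c * (1 - of_nat n)" "p \<le> 4"
  shows "A (n - p) (p + 1) = c * (of_nat (p + 1) - of_nat (n - p))"
proof -
  obtain m where m: "n = 16 + m" using n(1) le_Suc_ex by blast
  define N :: 'a where "N = of_nat n"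
  have sub: "of_nat (n - q) = N - of_nat q" if "q \<le> 16" for q
    unfolding N_def using that n by (simp add: of_nat_diff)
  \<comment> \<open>deviation from the expected solution; the relations for it are homogeneous\<close>
  define D where "D q = A (n - q) (q + 1) - c * (of_nat (q + 1) - of_nat (n - q))" for q
  have A: "A (n - q) (q + 1) = D q + c * (of_nat (q + 1) - (N - of_nat q))" if "q \<le> 4" for q
    using sub[of q] that by (simp add: D_def)
  have D0: "D 0 = 0" using assms(1) by (simp add: D_def)
  have step: "of_nat q * D (q + 1) = (of_nat q + 2 - N) * D q" if "q \<in> {1..3}" for q
  proof -
    define r where "r = n - (q + 1)"
    have ran: "q + 1 \<in> {1..n}" "r \<in> {1..n}" "11 < q + 1 + r"
      and eqs: "q + 1 + r = n" "r + 1 = n - q"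
      using that n by (auto simp: r_def)
    have "of_nat r = N - of_nat q - 1"
      using sub[of "q + 1"] that by (simp add: r_def)
    then have "of_nat q * A (q + 1 + 1) r + (N - 2 * of_nat q - 2) * A n 1
        = (N - of_nat q - 2) * A (n - q) (q + 1)"
      using shift_relation[OF ran, unfolded eqs] by simp
    moreover have "A n 1 = c * (1 - N)"
      using assms(1) by (simp add: N_def)
    moreover have "A (n - q) (q + 1) = D q + c * (2 * of_nat q + 1 - N)"
      using A[of q] that by (simp add: algebra_simps)
    moreover have "A (q + 1 + 1) r = - (D (q + 1) + c * (2 * of_nat q + 3 - N))"
      unfolding anti[of "q + 1 + 1" r] using A[of "q + 1"] that by (simp add: r_def algebra_simps)
    ultimately show ?thesis by algebra
  qed
  have "cyclic_sum (bracket_term y A) 2 3 (n - 4) = 0"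
    using n by (intro closed) auto
  moreover have "bracket_term y A 2 3 (n - 4) = A 5 (n - 4)"
    by (simp add: bracket_term_undeformed)
  moreover have "3 + (n - 4) = n - 1" "n - 4 + 2 = n - 2" "11 < n - 1" "11 < n - 2"
    using n by auto
  then have "bracket_term y A 3 (n - 4) 2 = (N - 7) * A (n - 1) 2"
    and "bracket_term y A (n - 4) 2 3 = (6 - N) * A (n - 2) 3"
    using n sub[of 4] bracket_term_undeformed[of 3 "n - 4" 2] bracket_term_undeformed[of "n - 4" 2 3]
    by simp_all
  ultimately have "A 5 (n - 4) + (N - 7) * A (n - 1) 2 + (6 - N) * A (n - 2) 3 = 0"
    by (simp add: cyclic_sum_def add.assoc)
  moreover have "A (n - 1) 2 = D 1 + c * (3 - N)" "A (n - 2) 3 = D 2 + c * (5 - N)"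
    using A[of 1] A[of 2] by (simp_all add: numeral_2_eq_2 numeral_3_eq_3 algebra_simps)
  moreover have "A 5 (n - 4) = - (D 4 + c * (9 - N))"
    unfolding anti[of 5 "n - 4"] using A[of 4] by (simp add: algebra_simps)
  ultimately have "D 4 = (N - 7) * D 1 + (6 - N) * D 2"
    by algebra
  moreover have steps: "D 2 = (3 - N) * D 1" "2 * D 3 = (4 - N) * D 2" "3 * D 4 = (5 - N) * D 3"
    using step[of 1] step[of 2] step[of 3] by (simp_all add: eval_nat_numeral)
  ultimately have "((N - 3) * (N - 4) * (N - 5) + 6 * (N - 7) + 6 * (N - 6) * (N - 3)) * D 1 = 0"
    by algebra
  \<comment> \<open>written in \<open>m = n - 16\<close>, the factor is visibly a positive integer\<close>
  moreover have "(N - 3) * (N - 4) * (N - 5) + 6 * (N - 7) + 6 * (N - 6) * (N - 3) =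
      of_nat ((m + 13) * (m + 12) * (m + 11) + 6 * (m + 9) + 6 * (m + 10) * (m + 13))"
    unfolding N_def m by (simp add: algebra_simps)
  ultimately have "D 1 = 0" by (metis mult_eq_0_iff of_nat_eq_0_iff add_eq_0_iff_both_eq_0 numeral_neq_zero)
  with steps have "D 2 = 0" "D 3 = 0" "D 4 = 0" by simp_all
  with \<open>D 1 = 0\<close> D0 have "D p = 0"
    using assms(2) by (auto simp: le_Suc_eq numeral_eq_Suc)
  then show ?thesis by (simp add: D_def)
qed

text \<open>The deformation by \<open>\<psi>\<^sub>n\<^sub>,\<^sub>7\<^sub>+\<^sub>s\<close> moves weight 12 to weight \<open>n + 5 - s\<close>, where \<open>A\<close> is zero unless
  \<open>s = 4\<close>.\<close>

lemma bracket_term_weight_12: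
  assumes "i + j + k = 12" "i + j = p + 7" "1 \<le> k"
  shows "bracket_term y A i j k = (of_nat j - of_nat i) * A (i + j) k
    + y 4 * (xi_coeff p (n - 4) i j * A (n - 4 + p) k)"
proof -
  have "y s * (\<Sum>q\<le>s. xi_coeff q (n - s) i j * A (n - s + q) k) = 0" if "s < 4" for s
  proof -
    have "xi_coeff q (n - s) i j * A (n - s + q) k = 0" for q
    proof (cases "q = p")
      case True
      then have "A (n - s + q) k = 0"
        using assms that n by (intro weight_above) auto
      then show ?thesis by simp
    qed (use assms(2) in \<open>simp add: xi_coeff_weight\<close>)
    then show ?thesis by (simp del: mult_eq_0_iff)
  qed
  then have "(\<Sum>s<4. y s * (\<Sum>q\<le>s. xi_coeff q (n - s) i j * A (n - s + q) k)) = 0"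
    by (intro sum.neutral) (simp del: mult_eq_0_iff)
  moreover have "(\<Sum>q\<le>4. xi_coeff q (n - 4) i j * A (n - 4 + q) k)
      = (\<Sum>q\<le>4. if q = p then xi_coeff p (n - 4) i j * A (n - 4 + p) k else 0)"
    using assms(2) by (intro sum.cong) (auto simp: xi_coeff_weight)
  then have "(\<Sum>q\<le>4. xi_coeff q (n - 4) i j * A (n - 4 + q) k)
      = xi_coeff p (n - 4) i j * A (n - 4 + p) k"
    using assms by (simp only: sum.delta finite_atMost) auto
  moreover have "{..4} = insert 4 {..<4::nat}" by auto
  then have "(\<Sum>s\<le>4. f s) = f 4 + (\<Sum>s<4. f s)" for f :: "nat \<Rightarrow> 'a" by simp
  ultimately show ?thesis
    unfolding bracket_term_def by simp
qed

text \<open>The four triples below carry the homology cycle of \<open>\<V>\<^sub>n\<close> in weight 12: in the combination with coefficients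
  \<open>3, -8, 9, 21\<close> of the corresponding equations the unknown entries of \<open>A\<close> drop out.\<close>

lemma obstruction:
  assumes "A n 1 \<noteq> 0"
  shows "y 4 = 0"
proof -
  obtain m where m: "n = m + 16" using n(1) le_Suc_ex by (metis add.commute)
  define c where "c = A n 1 / (1 - of_nat n)"
  have "of_nat n \<noteq> (1 :: 'a)" using n(1) by (metis of_nat_1 of_nat_eq_iff numeral_le_one_iff semiring_norm(69))
  then have c: "A n 1 = c * (1 - of_nat n)" by (simp add: c_def)
  have lead: "A (m + 16) 1 = c * (1 - of_nat (m + 16))"
    "A (m + 14) 3 = c * (3 - of_nat (m + 14))"
    "A (m + 13) 4 = c * (4 - of_nat (m + 13))"
    "A (m + 12) 5 = c * (5 - of_nat (m + 12))"
    using c weight_n_plus_1[OF c, of 2] weight_n_plus_1[OF c, of 3] weight_n_plus_1[OF c, of 4]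
    unfolding m by (simp_all add: add.commute[of m])
  have z: "cyclic_sum (bracket_term y A) 1 3 8 = 0" "cyclic_sum (bracket_term y A) 1 4 7 = 0"
    "cyclic_sum (bracket_term y A) 1 5 6 = 0" "cyclic_sum (bracket_term y A) 3 4 5 = 0"
    using n by (intro closed; simp)+
  have n4: "n - 4 = m + 12" unfolding m by simp
  have t138: "2 * A 4 8 + 5 * A 11 1 + y 4 * (Z2 (m + 12) * A (m + 16) 1) - 7 * A 9 3 = 0"
    using z(1) by (simp add: cyclic_sum_def bracket_term_undeformed
        bracket_term_weight_12[where p = 4] n4 add.commute[of _ m] add.assoc xi_coeff_def wedge_coeff_def)
  have t147: "3 * A 5 7 + 3 * A 11 1 + y 4 * (Z3 (m + 12) * A (m + 16) 1) - 6 * A 8 4 = 0"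
    using z(2) by (simp add: cyclic_sum_def bracket_term_undeformed
        bracket_term_weight_12[where p = 4] n4 add.commute[of _ m] add.assoc xi_coeff_def wedge_coeff_def)
  have t156: "4 * A 6 6 + A 11 1 + y 4 * (Z4 (m + 12) * A (m + 16) 1) - 5 * A 7 5 = 0"
    using z(3) by (simp add: cyclic_sum_def bracket_term_undeformed
        bracket_term_weight_12[where p = 4] n4 add.commute[of _ m] add.assoc xi_coeff_def wedge_coeff_def)
  have t345: "A 7 5 + A 9 3 - 2 * A 8 4 + y 4 * (P3 (m + 12) * A (m + 14) 3 - 3 * A (m + 12) 5
      + (of_nat (m + 12) - 1) * A (m + 13) 4) = 0"
  proof -
    have "xi_coeff 0 (m + 12) 3 4 = - 3" "xi_coeff 2 (m + 12) 4 5 = P3 (m + 12)"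
      "xi_coeff 1 (m + 12) 5 3 = of_nat (m + 12) - 1"
      by (simp_all add: xi_coeff_def wedge_coeff_def)
    moreover have "m + 12 + 2 = m + 14" "m + 12 + 1 = m + 13" by simp_all
    ultimately have "bracket_term y A 3 4 5 = A 7 5 - 3 * (y 4 * A (m + 12) 5)"
      "bracket_term y A 4 5 3 = A 9 3 + y 4 * (P3 (m + 12) * A (m + 14) 3)"
      "bracket_term y A 5 3 4 = - 2 * A 8 4 + y 4 * ((of_nat (m + 12) - 1) * A (m + 13) 4)"
      using bracket_term_weight_12[of 3 4 5 0] bracket_term_weight_12[of 4 5 3 2]
        bracket_term_weight_12[of 5 3 4 1] unfolding n4
      by (simp_all add: add.commute[of _ m])
    then show ?thesis
      using z(4) unfolding cyclic_sum_def by algebra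
  qed
  \<comment> \<open>the cycle cancels all entries of weight 12\<close>
  have "A 6 6 = 0" using anti[of 6 6] by simp
  with t138 t147 t156 t345 anti[of 8 4] anti[of 7 5]
  have "y 4 * ((3 * Z2 (m + 12) - 8 * Z3 (m + 12) + 9 * Z4 (m + 12)) * A (m + 16) 1
      + 21 * (P3 (m + 12) * A (m + 14) 3 - 3 * A (m + 12) 5
        + (of_nat (m + 12) - 1) * A (m + 13) 4)) = 0"
    by algebra
  then have "y 4 * (c * ((3 * Z2 (m + 12) - 8 * Z3 (m + 12) + 9 * Z4 (m + 12)) * (1 - of_nat (m + 16))
    + 21 * (P3 (m + 12) * (3 - of_nat (m + 14)) - 3 * (5 - of_nat (m + 12))
        + (of_nat (m + 12) - 1) * (4 - of_nat (m + 13))))) = 0"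
    unfolding lead by algebra
  then have "y 4 * (c * (5 * of_nat (m ^ 5 + 35 * m ^ 4 + 503 * m ^ 3 + 3589 * m\<^sup>2 + 12720 * m + 17712)
      / 132)) = 0"
    unfolding obstruction_value .
  moreover have "c \<noteq> 0" using assms c by auto
  moreover have "of_nat (m ^ 5 + 35 * m ^ 4 + 503 * m ^ 3 + 3589 * m\<^sup>2 + 12720 * m + 17712) \<noteq> (0 :: 'a)"
    unfolding of_nat_eq_0_iff by simp
  ultimately show ?thesis by (simp del: of_nat_add)
qed

end

text \<open>If \<open>\<omega>(e\<^sub>n, e\<^sub>1)\<close> were zero, \<open>e\<^sub>n\<close> would be orthogonal to everything, because all its other values have
  weight above \<open>n + 1\<close>.\<close>

lemma symplectic_imp_top_coordinate_0:
  assumes n: "16 \<le> n" "even n" and symp: "symplectic_structure scale (normal_bracket y) \<omega>"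
  shows "y 4 = 0"
proof -
  let ?A = "form_matrix \<omega>"
  have \<omega>: "bilinear_wrt scale (*) \<omega>" and skew: "\<And>u v. \<omega> u v = - \<omega> v u"
    and nondeg: "\<And>u. (\<And>v. \<omega> u v = 0) \<Longrightarrow> u = 0"
    using symp unfolding symplectic_structure_def skew_symmetric_def by blast+
  have anti: "?A b a = - ?A a b" for a b
    using skew[of "e b" "e a"] by (simp add: form_matrix_def)
  have outside: "?A a b = 0" if "n < a" for a b
    using that by (simp add: form_matrix_def)
  have closed: "cyclic_sum (bracket_term y ?A) i j k = 0"
    if "i \<in> {1..n}" "j \<in> {1..n}" "k \<in> {1..n}" for i j k
    using symp closed_iff_basis[OF \<omega>, of y] that n(1)
    unfolding symplectic_structure_def by auto
  have "?A n 1 \<noteq> 0"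
  proof
    assume A: "?A n 1 = 0"
    have "\<omega> (e n) (e b) = 0" if b: "b \<in> {1..n}" for b
    proof -
      have "?A n b = 0"
        using A b weight_above[OF n anti outside closed, of n b] by (cases "b = 1") auto
      then show ?thesis using b n by (simp add: form_matrix_def)
    qed
    moreover have "Vector_Spaces.linear scale (*) (\<omega> (e n))"
      using \<omega> by (simp add: bilinear_wrt_def)
    ultimately have "e n = 0"
      using linear_form_eq_0[of "\<omega> (e n)"] by (intro nondeg) blast
    moreover have "e n \<in> e ` {1..n}" using n by auto
    ultimately show False using independent_e dependent_zero by metis
  qed
  then show ?thesis using obstruction[where A = ?A and y = y, OF n] anti outside closed by blast
qed

section \<open>Invariance under the unitriangular group\<close>

lemma symplectic_structure_pullback:
  assumes "symplectic_structure scale B \<omega>"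
    and "\<And>u v. \<phi> (u + v) = \<phi> u + \<phi> v" "\<And>c u. \<phi> (c *s u) = c *s \<phi> u" "bij \<phi>"
  shows "symplectic_structure scale (\<lambda>u v. inv \<phi> (B (\<phi> u) (\<phi> v))) (\<lambda>u v. \<omega> (\<phi> u) (\<phi> v))"
proof -
  have \<omega>: "bilinear_wrt scale (*) \<omega>" and nondeg: "\<And>u. (\<And>v. \<omega> u v = 0) \<Longrightarrow> u = 0"
    using assms(1) unfolding symplectic_structure_def by blast+
  have surj: "\<phi> (inv \<phi> u) = u" for u
    using assms(4) by (simp add: bij_is_surj surj_f_inv_f)
  have "\<phi> 0 = 0" using assms(2)[of 0 0] by simp
  have "u = 0" if "\<forall>v. \<omega> (\<phi> u) (\<phi> v) = 0" for u
  proof -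
    have "\<omega> (\<phi> u) v = 0" for v using that surj by metis
    then have "\<phi> u = \<phi> 0" unfolding \<open>\<phi> 0 = 0\<close> by (rule nondeg)
    then show ?thesis using assms(4) by (meson bij_is_inj injD)
  qed
  then have nondeg': "\<forall>u. (\<forall>v. \<omega> (\<phi> u) (\<phi> v) = 0) \<longrightarrow> u = 0" by blast
  have skew: "\<forall>u v. \<omega> u v = - \<omega> v u"
    using assms(1) unfolding symplectic_structure_def skew_symmetric_def by (elim conjE)
  have closed: "\<forall>u v w. \<omega> (B u v) w + \<omega> (B v w) u + \<omega> (B w u) v = 0"
    using assms(1) unfolding symplectic_structure_def by (elim conjE)
  have bil: "bilinear_wrt scale (*) (\<lambda>u v. \<omega> (\<phi> u) (\<phi> v))"
    by (intro bilinear_wrtI vector_space_field) (simp_all add: assms(2,3) bilinear_wrtD[OF \<omega>])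
  show ?thesis
    unfolding symplectic_structure_def skew_symmetric_def surj
    by (intro conjI bil nondeg' allI; rule skew[rule_format] closed[rule_format])
qed

text \<open>\<open>\<phi>\<close> is an isomorphism from the algebra deformed by \<open>\<phi> \<star> \<Psi>\<close> onto the one deformed by \<open>\<Psi>\<close>.\<close>

lemma symplectic_structure_act_iff:
  assumes "\<phi> \<in> UT"
  shows "(\<exists>\<omega>. symplectic_structure scale (\<lambda>u v. bracket u v + act \<phi> \<Psi> u v) \<omega>) \<longleftrightarrow>
    (\<exists>\<omega>. symplectic_structure scale (\<lambda>u v. bracket u v + \<Psi> u v) \<omega>)"
proof -
  have \<phi>: "\<And>u v. \<phi> (u + v) = \<phi> u + \<phi> v" "\<And>c u. \<phi> (c *s u) = c *s \<phi> u" "bij \<phi>"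
    using assms by (auto simp: UT_def Vector_Spaces.linear_iff)
  have l: "inv \<phi> (\<phi> u) = u" and r: "\<phi> (inv \<phi> u) = u" for u
    using \<phi>(3) by (simp_all add: bij_is_inj bij_is_surj surj_f_inv_f)
  have inv: "inv \<phi> (u + v) = inv \<phi> u + inv \<phi> v" "inv \<phi> (c *s u) = c *s inv \<phi> u" "bij (inv \<phi>)" for u v c
    using \<phi> l r by (metis, metis, simp add: bij_imp_bij_inv)
  let ?B = "\<lambda>u v. bracket u v + \<Psi> u v"
  let ?B' = "\<lambda>u v. bracket u v + act \<phi> \<Psi> u v"
  have to: "?B' = (\<lambda>u v. inv \<phi> (?B (\<phi> u) (\<phi> v)))"
    by (simp add: act_def)
  have "inv (inv \<phi>) (?B' (inv \<phi> u) (inv \<phi> v)) = ?B u v" for u v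
    unfolding inv_inv_eq[OF \<phi>(3)] by (simp add: act_def r)
  then have "symplectic_structure scale ?B (\<lambda>u v. \<omega> (inv \<phi> u) (inv \<phi> v))"
    if "symplectic_structure scale ?B' \<omega>" for \<omega>
    using symplectic_structure_pullback[OF that inv] by simp
  moreover have "symplectic_structure scale ?B' (\<lambda>u v. \<omega> (\<phi> u) (\<phi> v))"
    if "symplectic_structure scale ?B \<omega>" for \<omega>
    using symplectic_structure_pullback[OF that \<phi>] unfolding to .
  ultimately show ?thesis by blast
qed

end

theorem corollary9p2:
  fixes scale :: "'a::field_char_0 \<Rightarrow> 'v::ab_group_add \<Rightarrow> 'v"
    and k :: nat and e :: "nat \<Rightarrow> 'v" and \<Psi> :: "'v \<Rightarrow> 'v \<Rightarrow> 'v"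
    and x\<^sub>1 x\<^sub>2 x\<^sub>3 x\<^sub>4 x\<^sub>5 :: 'a
  assumes "2 * k \<ge> 16"
    and "Vn_space scale (2 * k) e"
    and "\<Psi> \<in> Vn_space.deformations scale (2 * k) e"
    and "Vn_space.homogeneous_coordinates scale (2 * k) e
           (Vn_space.UT_orbit scale (2 * k) e \<Psi>) (x\<^sub>1, x\<^sub>2, x\<^sub>3, x\<^sub>4, x\<^sub>5)"
  shows "(\<exists>\<omega>. symplectic_structure scale
            (\<lambda>x y. Vn_space.bracket scale (2 * k) e x y + \<Psi> x y) \<omega>) \<longleftrightarrow> x\<^sub>1 = 0"
proof -
  interpret Vn_space scale "2 * k" e by fact
  define y where "y s = [x\<^sub>5, x\<^sub>4, x\<^sub>3, x\<^sub>2, x\<^sub>1] ! s" for s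
  have "normal_form y = (\<lambda>u v. scale x\<^sub>1 (psi 11 u v) + scale x\<^sub>2 (psi 10 u v)
      + scale x\<^sub>3 (psi 9 u v) + scale x\<^sub>4 (psi 8 u v) + scale x\<^sub>5 (psi 7 u v))"
  proof -
    have "{..4} = {0, 1, 2, 3, 4 :: nat}" by auto
    then show ?thesis by (simp add: normal_form_def y_def fun_eq_iff add_ac)
  qed
  then have "normal_form y \<in> UT_orbit \<Psi>"
    using assms(4) by (simp add: homogeneous_coordinates_def)
  then obtain \<phi> where \<phi>: "\<phi> \<in> UT" "normal_form y = act \<phi> \<Psi>"
    by (auto simp: UT_orbit_def)
  have "(\<exists>\<omega>. symplectic_structure scale (\<lambda>u v. bracket u v + \<Psi> u v) \<omega>)
      \<longleftrightarrow> (\<exists>\<omega>. symplectic_structure scale (normal_bracket y) \<omega>)"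
    using symplectic_structure_act_iff[OF \<phi>(1), of \<Psi>]
    unfolding \<phi>(2)[symmetric] normal_bracket_def[abs_def] by (rule sym)
  also have "\<dots> \<longleftrightarrow> y 4 = 0"
    using assms(1) extension_form_symplectic[of y] symplectic_imp_top_coordinate_0[of y] by auto
  finally show ?thesis by (simp add: y_def)
qed

end
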